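(* Let $G=(Y\cup Z,E)$ be a bipartite graph in which every vertex of $Y$ has valency $k$ and every vertex of $Z$ has valency $\ell$. Suppose that every vertex $y\in Y$ is locally distance-regular with parameters \[ \begin{vmatrix} k; & 1, & c_2^{Y}, & c_3^{Y}, & k\end{vmatrix}, \] i.e. $y$ has eccentricity $4$ and for each $i\in\{1,2,3,4\}$ and each vertex $w$ at distance $i$ from $y$, the number of neighbours of $w$ at distance $i-1$ from $y$ equals $1,c_2^Y,c_3^Y,k$ for $i=1,2,3,4$ respectively. Suppose further that there is a constant $c_2^{Z}$ such that for every $z\in Z$ and every vertex $w$ at distance two from $z$, the number of common neighbours of $z$ and $w$ equals $c_2^Z$, and that $k>\frac{c_2^{Y}c_3^{Y}}{c_2^{Z}}$. Then $G$ is distance-biregular with intersection array \[ \begin{vmatrix} k; & 1, & c_2^{Y}, & c_3^{Y}, & k \\ \ell; & 1, & c_2^{Z}, & \frac{c_2^{Y}c_3^{Y}}{c_2^{Z}}, & \ell\end{vmatrix}. \]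
   Context: For a vertex $a$ of a graph, $N_i(a)$ denotes the set of vertices at distance $i$ from $a$. A bipartite graph with bipartition $Y\cup Z$ is distance-biregular if for every vertex $a$, every $i$, and every vertex $w$ at distance $i$ from $a$, the numbers $c_i(a)=|\{u\sim w: d(a,u)=i-1\}|$ and $b_i(a)=|\{u\sim w: d(a,u)=i+1\}|$ depend only on $i$ and on which part ($Y$ or $Z$) contains $a$; these common values are denoted $c_i^Y,b_i^Y$ (for $a\in Y$) and $c_i^Z,b_i^Z$ (for $a\in Z$). The intersection array $\begin{vmatrix} k; & c_1^{Y}, & \dots, & c_{d_Y}^{Y} \\ \ell; & c_1^{Z}, & \dots, & c_{d_Z}^{Z}\end{vmatrix}$ records the valency $k$ of vertices in $Y$, the valency $\ell$ of vertices in $Z$, and the numbers $c_i$ for $1\le i\le d_Y$ (resp. $d_Z$), where $d_Y$ (resp. $d_Z$) is the eccentricity of vertices of $Y$ (resp. $Z$). *)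

theory Defs
  imports "Graph_Theory.Shortest_Path"
begin

text \<open>
  Graphs are finite simple undirected graphs, represented as symmetric digraphs by the locale
  \<^locale>\<open>graph\<close>; thus \<^const>\<open>out_degree\<close> is the valency of a vertex.
\<close>

definition bipartition :: "('a, 'b) pre_digraph \<Rightarrow> 'a set \<Rightarrow> 'a set \<Rightarrow> bool" where
  "bipartition G Y Z \<longleftrightarrow>
     verts G = Y \<union> Z \<and> Y \<inter> Z = {} \<and>
     (\<forall>u v. u \<rightarrow>\<^bsub>G\<^esub> v \<longrightarrow> (u \<in> Y \<and> v \<in> Z) \<or> (u \<in> Z \<and> v \<in> Y))"

definition nbrs :: "('a, 'b) pre_digraph \<Rightarrow> 'a \<Rightarrow> 'a set" where
  "nbrs G v = {u. v \<rightarrow>\<^bsub>G\<^esub> u}"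

definition gdist :: "('a, 'b) pre_digraph \<Rightarrow> 'a \<Rightarrow> 'a \<Rightarrow> ereal" where
  "gdist G u v = wf_digraph.\<mu> G (\<lambda>_. 1) u v"

lemma gdist_eq_INF_length:
  assumes "wf_digraph G"
  shows "gdist G u v = (INF p \<in> {p. pre_digraph.awalk G u p v}. ereal (real (length p)))"
  unfolding gdist_def wf_digraph.\<mu>_def[OF assms]
  by (simp add: wf_digraph.awalk_cost_def[OF assms] sum_list_triv)

definition sphere_at :: "('a, 'b) pre_digraph \<Rightarrow> nat \<Rightarrow> 'a \<Rightarrow> 'a set" where
  "sphere_at G i a = {w \<in> verts G. gdist G a w = ereal (real i)}"

definition eccentricity :: "('a, 'b) pre_digraph \<Rightarrow> 'a \<Rightarrow> ereal" where
  "eccentricity G a = (SUP w \<in> verts G. gdist G a w)"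

text \<open>
  For \<open>w\<close> at distance \<open>i\<close> from \<open>a\<close>, the following are the numbers \<open>c\<^sub>i(a)\<close> and \<open>b\<^sub>i(a)\<close>, computed
  at \<open>w\<close>. The subtraction \<open>i - 1\<close> is the one of real numbers, so \<open>c\<^sub>0(a) = 0\<close>.
\<close>

definition c_num :: "('a, 'b) pre_digraph \<Rightarrow> 'a \<Rightarrow> nat \<Rightarrow> 'a \<Rightarrow> nat" where
  "c_num G a i w = card {u \<in> nbrs G w. gdist G a u = ereal (real i - 1)}"

definition b_num :: "('a, 'b) pre_digraph \<Rightarrow> 'a \<Rightarrow> nat \<Rightarrow> 'a \<Rightarrow> nat" where
  "b_num G a i w = card {u \<in> nbrs G w. gdist G a u = ereal (real i + 1)}"

definition distance_biregular :: "('a, 'b) pre_digraph \<Rightarrow> 'a set \<Rightarrow> 'a set \<Rightarrow> bool" where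
  "distance_biregular G Y Z \<longleftrightarrow>
     graph G \<and> bipartition G Y Z \<and>
     (\<forall>P \<in> {Y, Z}. \<exists>c b :: nat \<Rightarrow> nat. \<forall>a \<in> P. \<forall>i. \<forall>w \<in> sphere_at G i a.
        c_num G a i w = c i \<and> b_num G a i w = b i)"

text \<open>
  The list \<open>[c\<^sub>1, \<dots>, c\<^sub>d]\<close> holds one row of an intersection array without the leading valency. Its
  entries are real numbers because they may be given by quotients such as
  \<open>c\<^sub>2\<^sup>Y c\<^sub>3\<^sup>Y / c\<^sub>2\<^sup>Z\<close>; that they are integers is part of the assertion.
\<close>

definition locally_distance_regular ::
    "('a, 'b) pre_digraph \<Rightarrow> 'a \<Rightarrow> nat \<Rightarrow> real list \<Rightarrow> bool" where
  "locally_distance_regular G a k cs \<longleftrightarrow>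
     out_degree G a = k \<and>
     eccentricity G a = ereal (real (length cs)) \<and>
     (\<forall>i \<in> {1..length cs}. \<forall>w \<in> sphere_at G i a. real (c_num G a i w) = cs ! (i - 1))"

definition has_intersection_array ::
    "('a, 'b) pre_digraph \<Rightarrow> 'a set \<Rightarrow> 'a set \<Rightarrow> nat \<Rightarrow> real list \<Rightarrow> nat \<Rightarrow> real list \<Rightarrow> bool" where
  "has_intersection_array G Y Z k cY l cZ \<longleftrightarrow>
     (\<forall>y \<in> Y. locally_distance_regular G y k cY) \<and>
     (\<forall>z \<in> Z. locally_distance_regular G z l cZ)"

end

theory Submission
  imports Defs
begin

text \<open>
  The walks of length three between \<open>z \<in> Z\<close> and a vertex \<open>y\<close> at distance three can be counted from
  either end: \<open>y\<close> sees \<open>c\<^sub>3\<^sup>Y c\<^sub>2\<^sup>Y\<close> of them and \<open>z\<close> sees \<open>c\<^sub>3(z) c\<^sub>2\<^sup>Z\<close>, which determines \<open>c\<^sub>3(z)\<close>. Since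
  vertices of \<open>Y\<close> have eccentricity four, parity bounds the distance between \<open>Y\<close> and \<open>Z\<close> by three,
  so \<open>z\<close> has eccentricity at most four and all neighbours of a vertex at distance four are at
  distance three. The inequality \<open>k > c\<^sub>3(z)\<close> makes distance four occur.
\<close>

section \<open>Distances as lengths of shortest walks\<close>

context wf_digraph
begin

text \<open>Relational powers forget the arcs of a walk and suit induction on its length. At
  \<open>n = 0\<close> the power is the identity on the whole type, whereas the empty walk needs a
  vertex; hence the assumption on \<open>u\<close>.\<close>

lemma ex_awalk_length_iff_relpow:
  assumes "u \<in> verts G"
  shows "(\<exists>p. awalk u p v \<and> length p = n) \<longleftrightarrow> (u, v) \<in> arcs_ends G ^^ n"
  using assms
proof (induction n arbitrary: u)
  case 0
  then show ?case by (auto simp: awalk_Nil_iff)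
next
  case (Suc n)
  have "(\<exists>p. awalk u p v \<and> length p = Suc n) \<longleftrightarrow>
      (\<exists>e p. e \<in> arcs G \<and> u = tail G e \<and> awalk (head G e) p v \<and> length p = n)"
    unfolding length_Suc_conv by (metis awalk_Cons_iff)
  also have "\<dots> \<longleftrightarrow> (\<exists>w. u \<rightarrow>\<^bsub>G\<^esub> w \<and> (\<exists>p. awalk w p v \<and> length p = n))"
    by (auto simp: arcs_ends_conv)
  also have "\<dots> \<longleftrightarrow> (\<exists>w. u \<rightarrow>\<^bsub>G\<^esub> w \<and> (w, v) \<in> arcs_ends G ^^ n)"
    using Suc.IH adj_in_verts by blast
  also have "\<dots> \<longleftrightarrow> (u, v) \<in> arcs_ends G ^^ Suc n"
    by (meson relpow_Suc_D2 relpow_Suc_I2)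
  finally show ?case .
qed

lemma gdist_le_relpow:
  assumes "u \<in> verts G" "(u, v) \<in> arcs_ends G ^^ n"
  shows "gdist G u v \<le> ereal (real n)"
proof -
  obtain p where "awalk u p v" "length p = n"
    using ex_awalk_length_iff_relpow assms by blast
  then show ?thesis
    unfolding gdist_eq_INF_length[OF wf_digraph] by (intro INF_lower2[of p]) auto
qed

text \<open>A finite infimum comes from a nonempty set of walks, since the empty infimum is
  \<infinity>, and a nonempty set of natural lengths has a least element.\<close>

lemma gdist_attained:
  assumes "u \<in> verts G" "gdist G u v \<noteq> \<infinity>"
  obtains n where "gdist G u v = ereal (real n)" "(u, v) \<in> arcs_ends G ^^ n"
proof -
  have "{p. awalk u p v} \<noteq> {}"
    using assms(2) unfolding gdist_eq_INF_length[OF wf_digraph] by (metis INF_empty top_ereal_def)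
  then obtain p where p: "awalk u p v" and min: "\<And>q. awalk u q v \<Longrightarrow> length p \<le> length q"
    using ex_has_least_nat[of "\<lambda>p. awalk u p v" _ length] by auto
  have "gdist G u v = ereal (real (length p))"
    unfolding gdist_eq_INF_length[OF wf_digraph]
  proof (rule antisym)
    show "(INF p \<in> {p. awalk u p v}. ereal (real (length p))) \<le> ereal (real (length p))"
      using p by (intro INF_lower) simp
    show "ereal (real (length p)) \<le> (INF p \<in> {p. awalk u p v}. ereal (real (length p)))"
      using min by (intro INF_greatest) simp
  qed
  then show thesis
    using that p ex_awalk_length_iff_relpow[OF assms(1)] by blast
qed

end

lemma (in graph) out_degree_eq_card_nbrs: "out_degree G v = card (nbrs G v)"
proof -
  have "nbrs G v = head G ` out_arcs G v"
    by (auto simp: nbrs_def arcs_ends_conv)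
  moreover have "inj_on (head G) (out_arcs G v)"
    by (rule inj_onI) (auto simp: arc_to_ends_def intro: no_multi_arcs)
  ultimately show ?thesis
    by (simp add: out_degree_def card_image)
qed

section \<open>Natural-valued distance and parity in connected bipartite graphs\<close>

locale connected_bipartite_graph = graph +
  fixes Y Z :: "'a set"
  assumes bip: "bipartition G Y Z"
    and gdist_finite: "u \<in> verts G \<Longrightarrow> v \<in> verts G \<Longrightarrow> gdist G u v \<noteq> \<infinity>"
begin

text \<open>A copy of \<open>gdist\<close> in the natural numbers, so that parity and successor
  arguments apply; the two agree on vertices because all distances there are finite.\<close>

definition ndist :: "'a \<Rightarrow> 'a \<Rightarrow> nat" where
  "ndist u v = (LEAST n. (u, v) \<in> arcs_ends G ^^ n)"

lemma verts_eq: "verts G = Y \<union> Z" and disjoint: "Y \<inter> Z = {}"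
  and adj_parts: "u \<rightarrow>\<^bsub>G\<^esub> v \<Longrightarrow> (u \<in> Y \<and> v \<in> Z) \<or> (u \<in> Z \<and> v \<in> Y)"
  using bip by (auto simp: bipartition_def)

lemma adj_sym: "u \<rightarrow>\<^bsub>G\<^esub> v \<Longrightarrow> v \<rightarrow>\<^bsub>G\<^esub> u"
  using arcs_ends_symmetric[OF sym_arcs] .

lemma finite_nbrs [simp]: "finite (nbrs G v)"
  by (rule finite_subset[OF _ finite_verts]) (auto simp: nbrs_def dest: adj_in_verts)

lemma nbrs_in_verts: "u \<in> nbrs G v \<Longrightarrow> u \<in> verts G"
  by (auto simp: nbrs_def dest: adj_in_verts)

lemma relpow_ndist:
  assumes "u \<in> verts G" "v \<in> verts G"
  shows "(u, v) \<in> arcs_ends G ^^ ndist u v"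
proof -
  obtain n where "(u, v) \<in> arcs_ends G ^^ n"
    using gdist_attained[OF assms(1) gdist_finite[OF assms]] by blast
  then show ?thesis
    unfolding ndist_def by (rule LeastI)
qed

lemma ndist_le: "(u, v) \<in> arcs_ends G ^^ n \<Longrightarrow> ndist u v \<le> n"
  unfolding ndist_def by (rule Least_le)

lemma gdist_eq_ndist:
  assumes "u \<in> verts G" "v \<in> verts G"
  shows "gdist G u v = ereal (real (ndist u v))"
proof (rule gdist_attained[OF assms(1) gdist_finite[OF assms]])
  fix n assume n: "gdist G u v = ereal (real n)" "(u, v) \<in> arcs_ends G ^^ n"
  then show ?thesis
    using ndist_le[OF n(2)] gdist_le_relpow[OF assms(1) relpow_ndist[OF assms]] by simp
qed

lemma ndist_sym:
  assumes "u \<in> verts G" "v \<in> verts G"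
  shows "ndist u v = ndist v u"
proof -
  have "(v, u) \<in> arcs_ends G ^^ n" if "(u, v) \<in> arcs_ends G ^^ n" for u v n
    using that
  proof (induction n arbitrary: v)
    case (Suc n)
    then obtain w where "(u, w) \<in> arcs_ends G ^^ n" "w \<rightarrow>\<^bsub>G\<^esub> v" by auto
    then show ?case using Suc.IH adj_sym by (meson relpow_Suc_I2)
  qed auto
  then show ?thesis
    using assms relpow_ndist ndist_le by (meson antisym)
qed

lemma ndist_eq_0_iff:
  assumes "u \<in> verts G" "v \<in> verts G"
  shows "ndist u v = 0 \<longleftrightarrow> u = v"
  using relpow_ndist[OF assms] ndist_le[of u v 0] by auto

lemma ndist_adj_le:
  assumes "a \<in> verts G" "w \<rightarrow>\<^bsub>G\<^esub> u"
  shows "ndist a u \<le> Suc (ndist a w)"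
  using relpow_ndist[OF assms(1), of w] assms(2) adj_in_verts
  by (intro ndist_le) (auto intro: relpow_Suc_I)

text \<open>Take the penultimate vertex of a shortest walk: were it closer to \<open>a\<close>, then
  so would be \<open>w\<close>.\<close>

lemma ndist_pred:
  assumes "a \<in> verts G" "w \<in> verts G" "ndist a w = Suc n"
  obtains u where "u \<in> nbrs G w" "ndist a u = n"
proof -
  obtain u where u: "(a, u) \<in> arcs_ends G ^^ n" "u \<rightarrow>\<^bsub>G\<^esub> w"
    using relpow_ndist[OF assms(1,2)] assms(3) by auto
  then have "ndist a u = n"
    using ndist_le[OF u(1)] ndist_adj_le[OF assms(1) u(2)] assms(3) by simp
  then show thesis
    using that u adj_sym by (auto simp: nbrs_def)
qed

text \<open>Each edge switches parts, so the ends of a walk fix the parity of its length.\<close>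

lemma ndist_even_iff:
  assumes "u \<in> verts G" "v \<in> verts G"
  shows "even (ndist u v) \<longleftrightarrow> (u \<in> Y \<longleftrightarrow> v \<in> Y)"
proof -
  have "even n \<longleftrightarrow> (u \<in> Y \<longleftrightarrow> v \<in> Y)" if "(u, v) \<in> arcs_ends G ^^ n" for n
    using that
  proof (induction n arbitrary: v)
    case (Suc n)
    then obtain w where "(u, w) \<in> arcs_ends G ^^ n" "w \<rightarrow>\<^bsub>G\<^esub> v" by auto
    then show ?case using Suc.IH adj_parts[of w v] disjoint by auto
  qed auto
  then show ?thesis
    using relpow_ndist[OF assms] by blast
qed

text \<open>Distances to adjacent vertices differ by at most one, and parity rules out
  equality.\<close>

lemma ndist_nbr_cases:
  assumes "a \<in> verts G" "u \<in> nbrs G w"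
  shows "ndist a u = Suc (ndist a w) \<or> ndist a w = Suc (ndist a u)"
proof -
  have adj: "w \<rightarrow>\<^bsub>G\<^esub> u" "u \<rightarrow>\<^bsub>G\<^esub> w"
    using assms(2) adj_sym by (auto simp: nbrs_def)
  have verts: "w \<in> verts G" "u \<in> verts G"
    using adj_in_verts[OF adj(1)] by auto
  have "even (ndist a u) \<noteq> even (ndist a w)"
    using assms(1) verts adj_parts[OF adj(1)] disjoint by (auto simp: ndist_even_iff)
  then show ?thesis
    using ndist_adj_le[OF assms(1) adj(1)] ndist_adj_le[OF assms(1) adj(2)]
    by (auto simp: le_Suc_eq)
qed

lemma ndist_eq_1_iff:
  assumes "u \<in> verts G" "v \<in> verts G"
  shows "ndist u v = 1 \<longleftrightarrow> v \<in> nbrs G u"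
proof
  assume "ndist u v = 1"
  then show "v \<in> nbrs G u"
    using relpow_ndist[OF assms] by (simp add: nbrs_def)
next
  assume "v \<in> nbrs G u"
  then show "ndist u v = 1"
    using ndist_nbr_cases[OF assms(1), of v u] ndist_eq_0_iff[OF assms(1,1)] by auto
qed

section \<open>Intersection numbers and eccentricity in terms of \<open>ndist\<close>\<close>

lemma sphere_at_iff:
  assumes "a \<in> verts G"
  shows "w \<in> sphere_at G i a \<longleftrightarrow> w \<in> verts G \<and> ndist a w = i"
  using assms by (auto simp: sphere_at_def gdist_eq_ndist)

text \<open>With \<open>Suc\<close> on the left the set is empty for \<open>i = 0\<close>, in line
  with the real subtraction in \<open>c_num\<close>; truncated subtraction would admit
  \<open>a\<close> itself.\<close>

lemma c_num_eq:
  assumes "a \<in> verts G"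
  shows "c_num G a i w = card {u \<in> nbrs G w. Suc (ndist a u) = i}"
  unfolding c_num_def
  by (rule arg_cong[where f = card]) (auto simp: gdist_eq_ndist[OF assms nbrs_in_verts])

lemma b_num_eq:
  assumes "a \<in> verts G"
  shows "b_num G a i w = card {u \<in> nbrs G w. ndist a u = Suc i}"
  unfolding b_num_def
  by (rule arg_cong[where f = card]) (auto simp: gdist_eq_ndist[OF assms nbrs_in_verts])

text \<open>No neighbour of \<open>w\<close> is as far from \<open>a\<close> as \<open>w\<close> is,
  so the two counted sets partition the neighbourhood.\<close>

lemma c_num_plus_b_num:
  assumes "a \<in> verts G" "w \<in> sphere_at G i a"
  shows "c_num G a i w + b_num G a i w = out_degree G w"
proof -
  have "nbrs G w = {u \<in> nbrs G w. Suc (ndist a u) = i} \<union> {u \<in> nbrs G w. ndist a u = Suc i}"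
    using assms ndist_nbr_cases by (fastforce simp: sphere_at_iff)
  moreover have "{u \<in> nbrs G w. Suc (ndist a u) = i} \<inter> {u \<in> nbrs G w. ndist a u = Suc i} = {}"
    by auto
  ultimately show ?thesis
    unfolding out_degree_eq_card_nbrs c_num_eq[OF assms(1)] b_num_eq[OF assms(1)]
    by (metis (lifting) card_Un_disjoint finite_Un finite_nbrs)
qed

lemma eccentricity_eq_iff:
  assumes "a \<in> verts G"
  shows "eccentricity G a = ereal (real n) \<longleftrightarrow>
    (\<forall>w \<in> verts G. ndist a w \<le> n) \<and> (\<exists>w \<in> verts G. ndist a w = n)"
proof -
  have "eccentricity G a = Max (gdist G a ` verts G)"
    unfolding eccentricity_def using assms by (intro cSup_eq_Max) auto
  then have "eccentricity G a = ereal (real n) \<longleftrightarrow>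
      ereal (real n) \<in> gdist G a ` verts G \<and> (\<forall>x \<in> gdist G a ` verts G. x \<le> ereal (real n))"
    using assms by (subst Max_eq_iff[symmetric]) auto
  then show ?thesis
    using assms by (auto simp: gdist_eq_ndist image_iff)
qed

text \<open>The valency of \<open>w\<close> depends only on the parity of its distance from
  \<open>a\<close>, so each \<open>b i\<close> is this valency minus \<open>c i\<close>. Stating it
  for a part \<open>P\<close> serves both \<open>Y\<close> and \<open>Z\<close>, with the valencies
  exchanged.\<close>

lemma intersection_numbers_of_part:
  assumes part: "P \<subseteq> verts G"
    and deg: "\<And>a w. a \<in> P \<Longrightarrow> w \<in> verts G \<Longrightarrow> out_degree G w = (if even (ndist a w) then p else q)"
    and reg: "\<And>a. a \<in> P \<Longrightarrow> locally_distance_regular G a p cs"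
  shows "\<exists>c b :: nat \<Rightarrow> nat. \<forall>a \<in> P. \<forall>i. \<forall>w \<in> sphere_at G i a.
    c_num G a i w = c i \<and> b_num G a i w = b i"
proof -
  \<comment> \<open>The floor loses nothing: on a nonempty sphere the real entry equals a
    cardinality. Indices past the end of \<open>cs\<close> belong to empty spheres, by the
    eccentricity.\<close>
  define c where "c i = (if i = 0 then 0 else nat \<lfloor>cs ! (i - 1)\<rfloor>)" for i
  define b where "b i = (if even i then p else q) - c i" for i
  have "c_num G a i w = c i \<and> b_num G a i w = b i" if a: "a \<in> P" and w: "w \<in> sphere_at G i a" for a i w
  proof -
    have av: "a \<in> verts G" using a part by auto
    then have wv: "w \<in> verts G" "ndist a w = i"
      using w by (auto simp: sphere_at_iff)
    then have "i \<le> length cs"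
      using reg[OF a] av by (auto simp: locally_distance_regular_def eccentricity_eq_iff)
    then have "real (c_num G a i w) = cs ! (i - 1)" if "i > 0"
      using that reg[OF a] w by (simp add: locally_distance_regular_def)
    then have c: "c_num G a i w = c i"
      using c_num_eq[OF av, of 0 w] unfolding c_def
      by (cases "i = 0") (simp, metis floor_of_nat gr0I nat_int)
    moreover have "c_num G a i w + b_num G a i w = (if even i then p else q)"
      using c_num_plus_b_num[OF av w] deg[OF a wv(1)] wv(2) by simp
    ultimately show ?thesis
      unfolding b_def by auto
  qed
  then show ?thesis by blast
qed

lemma distance_biregular_if_has_intersection_array:
  assumes arr: "has_intersection_array G Y Z k cY l cZ"
  shows "distance_biregular G Y Z"
proof -
  have deg: "out_degree G w = (if w \<in> Y then k else l)" if "w \<in> verts G" for w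
    using that arr verts_eq
    by (auto simp: has_intersection_array_def locally_distance_regular_def)
  have "\<exists>c b :: nat \<Rightarrow> nat. \<forall>a \<in> Y. \<forall>i. \<forall>w \<in> sphere_at G i a.
      c_num G a i w = c i \<and> b_num G a i w = b i"
    by (rule intersection_numbers_of_part[of Y k l cY])
      (use arr verts_eq deg in \<open>auto simp: has_intersection_array_def ndist_even_iff\<close>)
  moreover have "\<exists>c b :: nat \<Rightarrow> nat. \<forall>a \<in> Z. \<forall>i. \<forall>w \<in> sphere_at G i a.
      c_num G a i w = c i \<and> b_num G a i w = b i"
    by (rule intersection_numbers_of_part[of Z l k cZ])
      (use arr verts_eq disjoint deg in \<open>auto simp: has_intersection_array_def ndist_even_iff\<close>)
  ultimately show ?thesis
    using bip graph_axioms unfolding distance_biregular_def by auto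
qed

section \<open>The first, second, last and third intersection numbers\<close>

lemma c_num_1:
  assumes "a \<in> verts G" "w \<in> sphere_at G 1 a"
  shows "c_num G a 1 w = 1"
proof -
  have "a \<in> nbrs G w"
    using assms ndist_eq_1_iff ndist_sym by (metis sphere_at_iff)
  then have "{u \<in> nbrs G w. Suc (ndist a u) = 1} = {a}"
    using assms(1) by (auto simp: ndist_eq_0_iff nbrs_in_verts)
  then show ?thesis
    unfolding c_num_eq[OF assms(1)] by simp
qed

text \<open>This links \<open>c_num\<close> to the hypothesis on common neighbours of vertices of
  \<open>Z\<close>.\<close>

lemma c_num_2:
  assumes "a \<in> verts G"
  shows "c_num G a 2 w = card (nbrs G a \<inter> nbrs G w)"
  unfolding c_num_eq[OF assms]
  by (rule arg_cong[where f = card]) (use assms ndist_eq_1_iff nbrs_in_verts in auto)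

text \<open>Nothing lies beyond distance \<open>n\<close>, so \<open>b_num\<close> vanishes there
  and the whole valency is left for \<open>c_num\<close>.\<close>

lemma c_num_max:
  assumes "a \<in> verts G" "w \<in> sphere_at G n a" "\<And>v. v \<in> verts G \<Longrightarrow> ndist a v \<le> n"
  shows "c_num G a n w = out_degree G w"
proof -
  have "b_num G a n w = 0"
    using assms(3) nbrs_in_verts unfolding b_num_eq[OF assms(1)] by fastforce
  then show ?thesis
    using c_num_plus_b_num[OF assms(1,2)] by simp
qed

text \<open>Both sides count the walks of length three from \<open>a\<close> to \<open>b\<close>.\<close>

lemma c_num_3_double_count:
  assumes ab: "a \<in> verts G" "b \<in> verts G" "ndist a b = 3"
    and ca: "\<And>w. w \<in> sphere_at G 2 a \<Longrightarrow> c_num G a 2 w = ca"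
    and cb: "\<And>w. w \<in> sphere_at G 2 b \<Longrightarrow> c_num G b 2 w = cb"
  shows "c_num G a 3 b * ca = c_num G b 3 a * cb"
proof -
  have ba: "ndist b a = 3" using ab ndist_sym by metis
  \<comment> \<open>A walk is recorded by its inner vertices \<open>w\<close> next to
    \<open>b\<close> and \<open>x\<close> next to \<open>a\<close>; each admissible \<open>w\<close>
    leaves \<open>ca\<close> choices of \<open>x\<close>.\<close>
  have key: "card (SIGMA w : {u \<in> nbrs G b. Suc (ndist a u) = 3}. nbrs G a \<inter> nbrs G w)
      = c_num G a 3 b * ca"
    if "a \<in> verts G" "\<And>w. w \<in> sphere_at G 2 a \<Longrightarrow> c_num G a 2 w = ca" for a b ca
  proof -
    have "card (nbrs G a \<inter> nbrs G w) = ca" if "w \<in> nbrs G b" "Suc (ndist a w) = 3" for w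
      using that \<open>a \<in> verts G\<close> \<open>\<And>w. w \<in> sphere_at G 2 a \<Longrightarrow> c_num G a 2 w = ca\<close>[of w]
      by (simp add: c_num_2 sphere_at_iff nbrs_in_verts)
    then show ?thesis
      by (subst card_SigmaI) (auto simp: c_num_eq[OF \<open>a \<in> verts G\<close>])
  qed
  have walks: "(SIGMA w : {u \<in> nbrs G b. Suc (ndist a u) = 3}. nbrs G a \<inter> nbrs G w)
      = {(w, x). w \<in> nbrs G b \<and> x \<in> nbrs G a \<and> x \<in> nbrs G w}"
    if ab: "a \<in> verts G" "b \<in> verts G" "ndist a b = 3" for a b
  proof -
    \<comment> \<open>The distance condition on \<open>w\<close> is automatic: \<open>x\<close> at
      distance one allows 0 or 2, and \<open>b\<close> at distance three allows 2 or 4.\<close>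
    have "ndist a w = 2" if "w \<in> nbrs G b" "x \<in> nbrs G a" "x \<in> nbrs G w" for w x
    proof -
      have "ndist a x = 1"
        using that ab ndist_eq_1_iff nbrs_in_verts by blast
      then show ?thesis
        using that ndist_nbr_cases[OF ab(1), of w b] ndist_nbr_cases[OF ab(1), of x w] ab(3) by auto
    qed
    then show ?thesis by auto
  qed
  \<comment> \<open>Reversing a walk exchanges its two inner vertices.\<close>
  have "{(w, x). w \<in> nbrs G b \<and> x \<in> nbrs G a \<and> x \<in> nbrs G w}
      = prod.swap ` {(w, x). w \<in> nbrs G a \<and> x \<in> nbrs G b \<and> x \<in> nbrs G w}"
    using adj_sym by (auto simp: nbrs_def)
  then have "card {(w, x). w \<in> nbrs G b \<and> x \<in> nbrs G a \<and> x \<in> nbrs G w}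
      = card {(w, x). w \<in> nbrs G a \<and> x \<in> nbrs G b \<and> x \<in> nbrs G w}"
    by (simp add: card_image)
  moreover have "c_num G a 3 b * ca = card {(w, x). w \<in> nbrs G b \<and> x \<in> nbrs G a \<and> x \<in> nbrs G w}"
    using ca by (simp only: walks[OF ab] flip: key[OF ab(1)])
  moreover have "c_num G b 3 a * cb = card {(w, x). w \<in> nbrs G a \<and> x \<in> nbrs G b \<and> x \<in> nbrs G w}"
    using cb by (simp only: walks[OF ab(2,1) ba] flip: key[OF ab(2)])
  ultimately show ?thesis
    by simp
qed

end

text \<open>Every vertex is reachable from \<open>a\<close>, and adjacency is symmetric, so any two
  vertices are joined through \<open>a\<close>.\<close>

lemma (in graph) gdist_finite_if_eccentricity_finite:
  assumes "a \<in> verts G" "eccentricity G a \<noteq> \<infinity>" "u \<in> verts G" "v \<in> verts G"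
  shows "gdist G u v \<noteq> \<infinity>"
proof -
  have reach: "a \<rightarrow>\<^sup>* w" if "w \<in> verts G" for w
  proof -
    have "gdist G a w \<le> eccentricity G a"
      unfolding eccentricity_def using that by (rule SUP_upper)
    then show ?thesis
      using assms(2) by (auto simp: gdist_def simp flip: \<mu>_reach_conv[of "\<lambda>_. 1"])
  qed
  then have "u \<rightarrow>\<^sup>* v"
    using assms(3,4) symmetric_reachable[OF sym_arcs] reachable_trans by blast
  then show ?thesis
    by (simp add: gdist_def flip: \<mu>_reach_conv[of "\<lambda>_. 1"])
qed

section \<open>Determination of the row of \<open>Z\<close>\<close>

theorem theorem4p7:
  fixes G :: "('a, 'b) pre_digraph" and Y Z :: "'a set"
    and k l c2Y c3Y c2Z :: nat
  assumes "graph G"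
    and "bipartition G Y Z"
    and "Y \<noteq> {}"
    and "\<forall>y \<in> Y. out_degree G y = k"
    and "\<forall>z \<in> Z. out_degree G z = l"
    and "\<forall>y \<in> Y. locally_distance_regular G y k [1, real c2Y, real c3Y, real k]"
    and "\<forall>z \<in> Z. \<forall>w \<in> sphere_at G 2 z. card (nbrs G z \<inter> nbrs G w) = c2Z"
    and "real k > real c2Y * real c3Y / real c2Z"
  shows "distance_biregular G Y Z \<and>
    has_intersection_array G Y Z
      k [1, real c2Y, real c3Y, real k]
      l [1, real c2Z, real c2Y * real c3Y / real c2Z, real l]"
proof -
  obtain y0 where y0: "y0 \<in> Y" using assms(3) by auto
  interpret graph G by fact
  have Y_verts: "y \<in> verts G" if "y \<in> Y" for y
    using that assms(2) by (auto simp: bipartition_def)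
  have ecc: "eccentricity G y = ereal (real 4)" if "y \<in> Y" for y
    using that assms(6) by (auto simp: locally_distance_regular_def)
  interpret connected_bipartite_graph G Y Z
    using assms(2) gdist_finite_if_eccentricity_finite[OF Y_verts[OF y0]] ecc[OF y0]
    by unfold_locales auto
  have Z_verts: "z \<in> verts G" "z \<notin> Y" if "z \<in> Z" for z
    using that verts_eq disjoint by auto
  have Y_le: "ndist y w \<le> 4" if "y \<in> Y" "w \<in> verts G" for y w
    using that ecc Y_verts eccentricity_eq_iff by blast
  have Y_far: "\<exists>w \<in> verts G. ndist y w = 4" if "y \<in> Y" for y
    using that ecc Y_verts eccentricity_eq_iff by blast
  have cY: "c_num G y 2 w = c2Y" if "y \<in> Y" "w \<in> sphere_at G 2 y" for y w
    using that assms(6) by (fastforce simp: locally_distance_regular_def numeral_eq_Suc)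
  have c3Y: "c_num G y 3 w = c3Y" if "y \<in> Y" "w \<in> sphere_at G 3 y" for y w
    using that assms(6) by (fastforce simp: locally_distance_regular_def numeral_eq_Suc)
  have cZ: "c_num G z 2 w = c2Z" if "z \<in> Z" "w \<in> sphere_at G 2 z" for z w
    using that assms(7) Z_verts c_num_2 by simp
  have ZY: "ndist z y = 1 \<or> ndist z y = 3" if "z \<in> Z" "y \<in> Y" for z y
  proof -
    have "odd (ndist y z)" "ndist y z \<le> 4"
      using that Y_verts Z_verts Y_le by (auto simp: ndist_even_iff)
    then have "ndist y z = 1 \<or> ndist y z = 3" by presburger
    then show ?thesis
      using that Y_verts Z_verts ndist_sym by metis
  qed
  \<comment> \<open>Either \<open>w\<close> or its predecessor on a shortest walk from
    \<open>z\<close> lies in \<open>Y\<close>, hence at distance at most three.\<close>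
  have Z_le: "ndist z w \<le> 4" if zw: "z \<in> Z" "w \<in> verts G" for z w
  proof (cases "ndist z w")
    case (Suc n)
    obtain u where u: "u \<in> nbrs G w" "ndist z u = n"
      using ndist_pred[OF Z_verts(1)[OF zw(1)] zw(2) Suc] .
    then consider "w \<in> Y" | "u \<in> Y"
      using adj_parts by (auto simp: nbrs_def)
    then show ?thesis
      using ZY[OF zw(1)] u Suc by cases force+
  qed simp
  \<comment> \<open>Otherwise \<open>z\<close> would be adjacent to all of \<open>Y\<close>, and no
    vertex of \<open>Y\<close> could be at distance four from \<open>y0\<close>.\<close>
  have far3: "\<exists>y \<in> Y. ndist z y = 3" if z: "z \<in> Z" for z
  proof (rule ccontr)
    assume "\<not> ?thesis"
    then have all1: "ndist z y = 1" if "y \<in> Y" for y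
      using ZY[OF z that] that by auto
    obtain w where w: "w \<in> verts G" "ndist y0 w = 4"
      using Y_far[OF y0] by auto
    have "w \<in> Y"
      using w y0 Y_verts ndist_even_iff[of y0 w] by auto
    then have "y0 \<in> nbrs G z" "w \<in> nbrs G z"
      using all1 y0 w z Z_verts Y_verts ndist_eq_1_iff by blast+
    moreover have "ndist y0 z = 1"
      using all1[OF y0] ndist_sym Y_verts[OF y0] Z_verts[OF z] by metis
    ultimately show False
      using ndist_nbr_cases[OF Y_verts[OF y0], of w z] w by auto
  qed
  \<comment> \<open>Kept as a product until \<open>c2Z\<close> is known to be nonzero.\<close>
  have c3Z_mult: "c_num G z 3 y * c2Z = c3Y * c2Y" if "z \<in> Z" "y \<in> verts G" "ndist z y = 3" for z y
  proof -
    have y: "y \<in> Y"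
      using that Z_verts ndist_even_iff[of z y] by auto
    have "z \<in> sphere_at G 3 y"
      using that y Z_verts Y_verts ndist_sym sphere_at_iff by metis
    then show ?thesis
      using c_num_3_double_count[OF Z_verts(1)[OF that(1)] that(2,3) cZ[OF that(1)] cY[OF y]]
        c3Y[OF y] by simp
  qed
  \<comment> \<open>Since division by zero yields zero, the inequality for \<open>k\<close> does not
    imply this. Instead, descending from a vertex at distance four from \<open>y0\<close> gives
    \<open>z\<close> in \<open>Z\<close> at distance three, and then \<open>u\<close> at distance
    two from \<open>z\<close>; such a pair has a common neighbour \<open>v\<close>.\<close>
  have c2Z_pos: "c2Z > 0"
  proof -
    obtain w where w: "w \<in> verts G" "ndist y0 w = Suc 3"
      using Y_far[OF y0] by auto
    obtain z where z: "z \<in> nbrs G w" "ndist y0 z = 3"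
      using ndist_pred[OF Y_verts[OF y0] w] .
    then have zv: "z \<in> verts G" by (simp add: nbrs_in_verts)
    then have zZ: "z \<in> Z"
      using z(2) y0 Y_verts verts_eq ndist_even_iff[of y0 z] by auto
    have zy: "ndist z y0 = Suc 2"
      using z zv ndist_sym Y_verts[OF y0] by simp
    obtain u where u: "u \<in> nbrs G y0" "ndist z u = 2"
      using ndist_pred[OF zv Y_verts[OF y0] zy] .
    then have uv: "u \<in> verts G" "ndist z u = Suc 1"
      using nbrs_in_verts by auto
    obtain v where v: "v \<in> nbrs G u" "ndist z v = 1"
      using ndist_pred[OF zv uv] .
    then have "c_num G z 2 u \<noteq> 0"
      unfolding c_num_eq[OF zv] by (auto simp: card_eq_0_iff)
    moreover have "u \<in> sphere_at G 2 z"
      using u uv zv by (simp add: sphere_at_iff)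
    ultimately show ?thesis
      using cZ[OF zZ] by auto
  qed
  have c3Z: "real (c_num G z 3 y) = real c2Y * real c3Y / real c2Z"
    if "z \<in> Z" "y \<in> sphere_at G 3 z" for z y
    using c3Z_mult[of z y] that Z_verts c2Z_pos
    by (auto simp: sphere_at_iff field_simps simp flip: of_nat_mult)
  have far4: "\<exists>w \<in> verts G. ndist z w = 4" if z: "z \<in> Z" for z
  proof -
    obtain y where y: "y \<in> Y" "ndist z y = 3" using far3[OF z] by auto
    then have ys: "y \<in> sphere_at G 3 z"
      using Y_verts z Z_verts by (simp add: sphere_at_iff)
    \<comment> \<open>As \<open>y\<close> has valency \<open>k\<close>, some neighbour of
      \<open>y\<close> must lie farther from \<open>z\<close>.\<close>
    have "c_num G z 3 y < k"
      using c3Z[OF z ys] assms(8) by simp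
    then have "b_num G z 3 y \<noteq> 0"
      using c_num_plus_b_num[OF Z_verts(1)[OF z] ys] assms(4) y by auto
    then obtain w where "w \<in> nbrs G y" "ndist z w = Suc 3"
      unfolding b_num_eq[OF Z_verts(1)[OF z]] by (auto simp: card_eq_0_iff)
    then show ?thesis
      using nbrs_in_verts by auto
  qed
  have c4Z: "c_num G z 4 w = l" if "z \<in> Z" "w \<in> sphere_at G 4 z" for z w
  proof -
    have "w \<in> verts G" "ndist z w = 4"
      using that Z_verts by (auto simp: sphere_at_iff)
    \<comment> \<open>An even distance stays in the part of \<open>z\<close>, so the valency of
      \<open>w\<close> is \<open>l\<close>.\<close>
    then have "w \<in> Z"
      using ndist_even_iff[of z w] Z_verts[OF that(1)] verts_eq by auto
    then show ?thesis
      using c_num_max[OF Z_verts(1)[OF that(1)] that(2) Z_le[OF that(1)]] assms(5) by simp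
  qed
  have "locally_distance_regular G z l [1, real c2Z, real c2Y * real c3Y / real c2Z, real l]"
    if z: "z \<in> Z" for z
  proof -
    have "eccentricity G z = ereal (real 4)"
      using Z_le[OF z] far4[OF z] Z_verts[OF z] eccentricity_eq_iff by blast
    moreover have "{1..4::nat} = {1, 2, 3, 4}" by auto
    ultimately show ?thesis
      using assms(5) z c_num_1 Z_verts cZ c3Z c4Z
      by (simp add: locally_distance_regular_def numeral_eq_Suc)
  qed
  then have "has_intersection_array G Y Z k [1, real c2Y, real c3Y, real k]
      l [1, real c2Z, real c2Y * real c3Y / real c2Z, real l]"
    using assms(6) by (simp add: has_intersection_array_def)
  then show ?thesis
    using distance_biregular_if_has_intersection_array by blast
qed

end
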